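(* For every $n\ge5$, $$|K_{V_n}|=5\cdot2^{n-4},\qquad \#\mathrm{comp}(K_{V_n})=2^{n-4},\qquad h(V_n)=3\cdot2^{n-4}-2n+5.$$
   Context: For a finite integer sequence $S=(s_1,\ldots,s_n)$, its difference triangle is defined by $s_a^0:=s_a$ and $s_a^b:=|s_{a+1}^{b-1}-s_a^{b-1}|$ for $b\ge 1$, $1\le a\le n-b$ (superscripts of $s$ are row indices, not powers). $S$ is Gilbreath if $s_1^b=1$ for every $1\le b\le n-1$. The valid-extension set of a Gilbreath sequence $S$ is $K_S:=\{k\in\mathbb{Z}:(s_1,\ldots,s_n,k)\text{ is Gilbreath}\}$. The right anti-diagonal of $S$ is $(e_1,\ldots,e_{n-1})$ with $e_i:=s_{n-i}^i$, and $A(S):=\sum_{i=1}^{n-1}e_i$. The candidate set is $C_S:=\{k\in\mathbb{Z}:|k-s_n|\le A(S)+1,\ k\equiv s_n\pmod 2\}$, the hole set is $H_S:=C_S\setminus K_S$, and the defect is $h(S):=|H_S|$. For a finite set $X\subseteq\mathbb{Z}$ all of one parity class, $\#\mathrm{comp}(X)$ is the number of maximal runs of common difference $2$ in $X$. For $n\ge5$, $V_n:=(v_1,\ldots,v_n)$ with $v_1=2$, $v_i=2^{i-1}+1$ for $2\le i\le n-1$, and $v_n=2^{n-1}-1$ (this is a strictly increasing Gilbreath sequence). *)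

theory Defs
  imports Main "HOL-Number_Theory.Cong"
begin

text \<open>
  A finite integer sequence \<open>(s\<^sub>1, \<dots>, s\<^sub>n)\<close> is a list of length \<open>n\<close>. Indices are 1-based,
  so \<open>s\<^sub>a\<close> is \<open>S ! (a - 1)\<close>. The value \<open>entry S b a\<close> is the \<open>a\<close>-th entry of row \<open>b\<close> of the
  difference triangle; it is meaningful only for \<open>1 \<le> a \<le> n - b\<close>, and every use below stays
  within that range.
\<close>

fun entry :: "int list \<Rightarrow> nat \<Rightarrow> nat \<Rightarrow> int" where
  "entry S 0 a = S ! (a - 1)"
| "entry S (Suc b) a = \<bar>entry S b (a + 1) - entry S b a\<bar>"

definition gilbreath :: "int list \<Rightarrow> bool" where
  "gilbreath S \<longleftrightarrow> (\<forall>b. 1 \<le> b \<and> b \<le> length S - 1 \<longrightarrow> entry S b 1 = 1)"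

definition valid_extensions :: "int list \<Rightarrow> int set" where
  "valid_extensions S = {k. gilbreath (S @ [k])}"

definition antidiagonal_sum :: "int list \<Rightarrow> int" where
  "antidiagonal_sum S = (\<Sum>i = 1..length S - 1. entry S i (length S - i))"

definition candidates :: "int list \<Rightarrow> int set" where
  "candidates S = {k. \<bar>k - last S\<bar> \<le> antidiagonal_sum S + 1 \<and> [k = last S] (mod 2)}"

definition holes :: "int list \<Rightarrow> int set" where
  "holes S = candidates S - valid_extensions S"

definition defect :: "int list \<Rightarrow> nat" where
  "defect S = card (holes S)"

definition is_run :: "int set \<Rightarrow> bool" where
  "is_run R \<longleftrightarrow> (\<exists>a m. R = (\<lambda>i::nat. a + 2 * int i) ` {0..m})"

definition maximal_runs :: "int set \<Rightarrow> int set set" where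
  "maximal_runs X =
     {R. is_run R \<and> R \<subseteq> X \<and> (\<forall>R'. is_run R' \<and> R' \<subseteq> X \<and> R \<subseteq> R' \<longrightarrow> R' = R)}"

definition num_comp :: "int set \<Rightarrow> nat" where
  "num_comp X = card (maximal_runs X)"

definition V_term :: "nat \<Rightarrow> nat \<Rightarrow> int" where
  "V_term n i =
     (if i = 1 then 2 else if i \<le> n - 1 then 2 ^ (i - 1) + 1 else 2 ^ (n - 1) - 1)"

definition V_seq :: "nat \<Rightarrow> int list" where
  "V_seq n = map (V_term n) [1..<n + 1]"

end

theory Submission
  imports Defs
begin

text \<open>
  Appending \<open>k\<close> adds to the difference triangle one anti-diagonal, obtained from \<open>k\<close> by folding
  \<open>d \<mapsto> \<bar>d - e\<bar>\<close> successively along \<open>s\<^sub>n\<close> and the old right anti-diagonal, and \<open>k\<close> is valid iff the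
  last value is \<open>1\<close>. For \<open>V\<^sub>n\<close> the old anti-diagonal, read from its end, is
  \<open>1, 0, 2, 6, 14, 30, \<dots>\<close>, the entry in column \<open>a \<ge> 2\<close> being \<open>2\<^sup>a\<^sup>-\<^sup>1 - 2\<close>. Pulling the condition
  back through the folds \<open>1, 0, 2, 6\<close> leaves the run \<open>{2, 4, 6, 8, 10}\<close>; every further fold,
  including the last one at \<open>s\<^sub>n\<close>, replaces a set \<open>X\<close> of positive numbers by \<open>e + X \<union> (e - X)\<close>,
  which doubles the number of length-5 runs and keeps them separated.
\<close>

section \<open>The anti-diagonal created by one new term\<close>

lemma entry_append:
  assumes "1 \<le> a" "a + b \<le> length S"
  shows "entry (S @ [k]) b a = entry S b a"
  using assms by (induction b arbitrary: a) (auto simp: nth_append)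

lemma gilbreath_append_iff:
  assumes "gilbreath S" "S \<noteq> []"
  shows "gilbreath (S @ [k]) \<longleftrightarrow> entry (S @ [k]) (length S) 1 = 1"
proof -
  have len: "length S \<ge> 1"
    using assms(2) by (cases S) auto
  have old: "entry (S @ [k]) b 1 = 1" if "1 \<le> b" "b \<le> length S - 1" for b
    using that assms(1) len by (subst entry_append) (auto simp: gilbreath_def)
  have "b = length S" if "1 \<le> b" "b \<le> length S" "\<not> b \<le> length S - 1" for b
    using that by linarith
  then show ?thesis
    using old len unfolding gilbreath_def
    by (metis diff_add_inverse2 length_append_singleton Suc_eq_plus1 order_refl)
qed

text \<open>Indexing the new anti-diagonal by column makes each fold a step from column
  \<open>a + 1\<close> to column \<open>a\<close>; the case \<open>a = length S\<close> is the fold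
  at the last term of \<open>S\<close>.\<close>

lemma antidiagonal_append:
  assumes "1 \<le> a" "a \<le> length S"
  shows "entry (S @ [k]) (length S + 1 - a) a
    = \<bar>entry (S @ [k]) (length S + 1 - (a + 1)) (a + 1) - entry S (length S - a) a\<bar>"
proof -
  have "length S + 1 - a = Suc (length S - a)"
    using assms by simp
  then show ?thesis
    using assms entry_append[of a "length S - a" S k] by simp
qed

section \<open>The difference triangle of \<open>V\<^sub>n\<close>\<close>

lemma length_V_seq [simp]: "length (V_seq n) = n"
  by (simp add: V_seq_def)

lemma nth_V_seq: "1 \<le> a \<Longrightarrow> a \<le> n \<Longrightarrow> V_seq n ! (a - 1) = V_term n a"
  by (simp add: V_seq_def nth_append del: upt_Suc)

text \<open>The bound keeps the last term out of reach. The terms before it are all 2^(i-1) + 1,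
  including 2 = 2^0 + 1, and powers of two reproduce under differences: 2^a - 2^(a-1) =
  2^(a-1).\<close>

lemma entry_V_seq_inner:
  assumes "1 \<le> a" "a + Suc b \<le> n - 1"
  shows "entry (V_seq n) (Suc b) a = 2 ^ (a - 1)"
  using assms
proof (induction b arbitrary: a)
  case 0
  then obtain c where "a = Suc c"
    by (cases a) auto
  then show ?case
    using 0 nth_V_seq[of a n] nth_V_seq[of "a + 1" n] by (cases c) (auto simp: V_term_def)
next
  case (Suc b)
  then obtain c where "a = Suc c"
    by (cases a) auto
  then show ?case
    using Suc.IH[of a] Suc.IH[of "a + 1"] Suc.prems
    by (simp del: entry.simps add: entry.simps(2)[of _ "Suc b"])
qed

text \<open>The last term falls 2 short of the pattern 2^(i-1) + 1. This shortfall passes unchanged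
  down the anti-diagonal as long as 2^(a-1) - 2 is nonnegative, that is, for \<open>a\<close> at
  least 2.\<close>

lemma entry_V_seq_antidiagonal:
  assumes "n \<ge> 5" "2 \<le> a" "a \<le> n - 1"
  shows "entry (V_seq n) (n - a) a = 2 ^ (a - 1) - 2"
proof -
  have "entry (V_seq n) (Suc b) a = 2 ^ (a - 1) - 2" if "2 \<le> a" "a + Suc b = n" for a b
    using that
  proof (induction b arbitrary: a)
    case 0
    then obtain c where c: "a = Suc (Suc c)"
      by (metis add_2_eq_Suc le_Suc_ex)
    have "(2::int) ^ c \<ge> 1"
      by simp
    then show ?case
      using assms(1) 0 c nth_V_seq[of a n] nth_V_seq[of "a + 1" n] by (auto simp: V_term_def)
  next
    case (Suc b)
    then obtain c where c: "a = Suc (Suc c)"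
      by (metis add_2_eq_Suc le_Suc_ex)
    \<comment> \<open>This gives 2^(a-1) - 2 = 2 * (2^c - 1) >= 0, so the absolute value
      disappears.\<close>
    have "(2::int) ^ c \<ge> 1"
      by simp
    then show ?case
      using assms(1) Suc.IH[of "a + 1"] entry_V_seq_inner[of a b n] Suc.prems c
      by (simp del: entry.simps add: entry.simps(2)[of _ "Suc b"])
  qed
  moreover have "n - a = Suc (n - a - 1)" "a + Suc (n - a - 1) = n"
    using assms by auto
  ultimately show ?thesis
    using assms(2) by metis
qed

text \<open>In column 1 the pattern 2^(a-1) - 2 would give -1; the absolute value turns it into
  1.\<close>

lemma entry_V_seq_last:
  assumes "n \<ge> 5"
  shows "entry (V_seq n) (n - 1) 1 = 1"
proof -
  obtain m where m: "n = m + 5"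
    using assms by (metis add.commute le_Suc_ex)
  have "entry (V_seq n) (Suc (m + 2)) 1 = 1" "entry (V_seq n) (Suc (m + 2)) 2 = 0"
    using entry_V_seq_inner[of 1 "m + 2" n] entry_V_seq_antidiagonal[of n 2] m
    by (simp_all del: entry.simps add: eval_nat_numeral)
  moreover have "n - 1 = Suc (Suc (m + 2))"
    using m by simp
  moreover have "entry (V_seq n) (Suc (Suc (m + 2))) 1
      = \<bar>entry (V_seq n) (Suc (m + 2)) 2 - entry (V_seq n) (Suc (m + 2)) 1\<bar>"
    by (metis entry.simps(2) one_add_one)
  ultimately show ?thesis
    by (simp del: entry.simps)
qed

lemma gilbreath_V_seq:
  assumes "n \<ge> 5"
  shows "gilbreath (V_seq n)"
  unfolding gilbreath_def
proof (intro allI impI)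
  fix b assume b: "1 \<le> b \<and> b \<le> length (V_seq n) - 1"
  show "entry (V_seq n) b 1 = 1"
  proof (cases "b = n - 1")
    case True
    then show ?thesis
      using entry_V_seq_last[OF assms] by simp
  next
    case False
    then show ?thesis
      using b entry_V_seq_inner[of 1 "b - 1" n] by simp
  qed
qed

lemma antidiagonal_sum_V_seq:
  assumes "n \<ge> 5"
  shows "antidiagonal_sum (V_seq n) = 2 ^ (n - 1) - 2 * int n + 3"
proof -
  have pow: "(\<Sum>a = 2..N. 2 ^ (a - 1) - 2) = (2::int) ^ N - 2 * int N" if "N \<ge> 1" for N
    using that
  proof (induction N rule: dec_induct)
    case (step N)
    then show ?case
      by simp
  qed simp
  have "antidiagonal_sum (V_seq n) = (\<Sum>a = 1..n - 1. entry (V_seq n) (n - a) a)"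
    unfolding antidiagonal_sum_def length_V_seq
    using assms by (intro sum.reindex_bij_witness[of _ "\<lambda>a. n - a" "\<lambda>i. n - i"]) auto
  also have "\<dots> = entry (V_seq n) (n - 1) 1 + (\<Sum>a = 2..n - 1. entry (V_seq n) (n - a) a)"
    using assms by (subst sum.atLeast_Suc_atMost) (auto simp: numeral_2_eq_2)
  also have "(\<Sum>a = 2..n - 1. entry (V_seq n) (n - a) a) = (\<Sum>a = 2..n - 1. 2 ^ (a - 1) - 2)"
  proof (rule sum.cong)
    fix a assume "a \<in> {2..n - 1}"
    then show "entry (V_seq n) (n - a) a = 2 ^ (a - 1) - 2"
      using entry_V_seq_antidiagonal[OF assms] by simp
  qed simp
  also have "\<dots> = 2 ^ (n - 1) - 2 * int (n - 1)"
    using assms by (intro pow) simp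
  finally show ?thesis
    using assms by (simp del: One_nat_def add: entry_V_seq_last of_nat_diff)
qed

section \<open>Separated length-5 runs\<close>

definition block :: "int \<Rightarrow> int set" where
  "block z = {z - 4, z - 2, z, z + 2, z + 4}"

text \<open>At distance 10 two blocks would join into one run, since z + 4 and z + 6 differ by 2; 12
  is the least even distance that leaves a gap.\<close>

definition separated :: "int set \<Rightarrow> bool" where
  "separated Z \<longleftrightarrow> (\<forall>z\<in>Z. \<forall>w\<in>Z. z \<noteq> w \<longrightarrow> \<bar>z - w\<bar> \<ge> 12)"

text \<open>For nonnegative \<open>Z\<close> this is the preimage of \<open>Z\<close> under d
  \<mapsto> |d - c|. Blocks are symmetric, so it suffices to track their centres.\<close>

definition reflect :: "int \<Rightarrow> int set \<Rightarrow> int set" where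
  "reflect c Z = (\<lambda>z. c + z) ` Z \<union> (\<lambda>z. c - z) ` Z"

lemma card_block: "card (block z) = 5"
  by (simp add: block_def)

lemma disjoint_blocks:
  assumes "separated Z" "z \<in> Z" "w \<in> Z" "x \<in> block z" "x \<in> block w"
  shows "z = w"
proof (rule ccontr)
  assume "z \<noteq> w"
  then have "\<bar>z - w\<bar> \<ge> 12"
    using assms by (auto simp: separated_def)
  then show False
    using assms(4,5) by (auto simp: block_def)
qed

lemma card_Union_blocks:
  assumes "finite Z" "separated Z"
  shows "card (\<Union>z\<in>Z. block z) = 5 * card Z"
proof -
  have "card (\<Union>z\<in>Z. block z) = (\<Sum>z\<in>Z. card (block z))"
  proof (rule card_UN_disjoint)
    show "\<forall>z\<in>Z. finite (block z)"
      by (simp add: block_def)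
    show "\<forall>z\<in>Z. \<forall>w\<in>Z. z \<noteq> w \<longrightarrow> block z \<inter> block w = {}"
      using disjoint_blocks[OF assms(2)] by blast
  qed (fact assms(1))
  then show ?thesis
    by (simp add: card_block)
qed

lemma is_run_block: "is_run (block z)"
proof -
  have "{0..4::nat} = {0, 1, 2, 3, 4}"
    by auto
  then have "block z = (\<lambda>i. (z - 4) + 2 * int i) ` {0..4}"
    by (auto simp: block_def)
  then show ?thesis
    unfolding is_run_def by blast
qed

text \<open>Walking along the run, consecutive elements differ by 2, so the centres of their blocks
  differ by at most 10 and therefore coincide.\<close>

lemma run_within_block:
  assumes "separated Z" "is_run R" "R \<subseteq> (\<Union>z\<in>Z. block z)"
  shows "\<exists>z\<in>Z. R \<subseteq> block z"
proof -
  obtain a m where R: "R = (\<lambda>i. a + 2 * int i) ` {0..m}"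
    using assms(2) by (auto simp: is_run_def)
  have "a \<in> R"
    unfolding R by (rule image_eqI[of _ _ 0]) auto
  then obtain z where z: "z \<in> Z" "a \<in> block z"
    using assms(3) by auto
  have "a + 2 * int i \<in> block z" if "i \<le> m" for i
    using that
  proof (induction i)
    case 0
    then show ?case
      using z by simp
  next
    case (Suc i)
    have "a + 2 * int (Suc i) \<in> R"
      unfolding R using Suc.prems by (intro imageI) auto
    then obtain w where w: "w \<in> Z" "a + 2 * int (Suc i) \<in> block w"
      using assms(3) by blast
    have "a + 2 * int i \<in> block z"
      using Suc by simp
    with w(2) have "\<bar>z - w\<bar> < 12"
      by (auto simp: block_def)
    then have "z = w"
      using assms(1) z(1) w(1) by (force simp: separated_def)
    then show ?case
      using w by simp
  qed
  then have "R \<subseteq> block z"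
    using R by auto
  then show ?thesis
    using z by blast
qed

lemma num_comp_Union_blocks:
  assumes "separated Z"
  shows "num_comp (\<Union>z\<in>Z. block z) = card Z"
proof -
  let ?X = "\<Union>z\<in>Z. block z"
  have mem: "z \<in> block z" for z
    by (simp add: block_def)
  have "maximal_runs ?X = block ` Z"
  proof (intro equalityI subsetI)
    fix R assume "R \<in> maximal_runs ?X"
    then have R: "is_run R" "R \<subseteq> ?X"
      and max: "\<And>R'. is_run R' \<Longrightarrow> R' \<subseteq> ?X \<Longrightarrow> R \<subseteq> R' \<Longrightarrow> R' = R"
      by (auto simp only: maximal_runs_def mem_Collect_eq)
    obtain z where z: "z \<in> Z" "R \<subseteq> block z"
      using run_within_block[OF assms R] by blast
    have "block z \<subseteq> ?X"
      using z(1) by (rule UN_upper)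
    then show "R \<in> block ` Z"
      using max[OF is_run_block _ z(2)] z(1) by blast
  next
    fix R assume "R \<in> block ` Z"
    then obtain z where z: "z \<in> Z" "R = block z"
      by blast
    have "R' = R" if R': "is_run R'" "R' \<subseteq> ?X" "R \<subseteq> R'" for R'
    proof -
      obtain w where w: "w \<in> Z" "R' \<subseteq> block w"
        using run_within_block[OF assms R'(1,2)] by blast
      then have "z = w"
        using disjoint_blocks[OF assms z(1) w(1) mem] mem[of z] z(2) R'(3) by blast
      then show ?thesis
        using w z R' by blast
    qed
    then show "R \<in> maximal_runs ?X"
      using z is_run_block unfolding maximal_runs_def by blast
  qed
  moreover have "inj_on block Z"
    using disjoint_blocks[OF assms] mem by (metis inj_onI)
  ultimately show ?thesis
    by (simp add: num_comp_def card_image)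
qed

text \<open>Centres on the same side of \<open>c\<close> keep their distance; on opposite sides the
  distance is z + w, at least 6 + 6 = 12.\<close>

lemma separated_reflect:
  assumes "separated Z" "\<And>z. z \<in> Z \<Longrightarrow> z \<ge> 6"
  shows "separated (reflect c Z)"
  unfolding separated_def
proof (intro ballI impI)
  fix x y assume "x \<in> reflect c Z" "y \<in> reflect c Z" "x \<noteq> y"
  moreover from this obtain z w where zw: "z \<in> Z" "w \<in> Z"
    and "x = c + z \<or> x = c - z" "y = c + w \<or> y = c - w"
    unfolding reflect_def by blast
  moreover have "z = w \<or> \<bar>z - w\<bar> \<ge> 12" "z \<ge> 6" "w \<ge> 6"
    using assms zw by (auto simp: separated_def)
  ultimately show "\<bar>x - y\<bar> \<ge> 12"
    by (elim disjE) simp_all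
qed

lemma card_reflect:
  assumes "finite Z" "\<And>z. z \<in> Z \<Longrightarrow> z > 0"
  shows "card (reflect c Z) = 2 * card Z"
proof -
  have "(\<lambda>z. c + z) ` Z \<inter> (\<lambda>z. c - z) ` Z = {}"
  proof (intro equals0I)
    fix x assume "x \<in> (\<lambda>z. c + z) ` Z \<inter> (\<lambda>z. c - z) ` Z"
    then obtain z w where "z \<in> Z" "w \<in> Z" "c + z = c - w"
      by auto
    then show False
      using assms(2)[of z] assms(2)[of w] by simp
  qed
  then show ?thesis
    unfolding reflect_def using assms(1)
    by (simp add: card_Un_disjoint card_image inj_on_def)
qed

text \<open>A centre of at least 6 keeps its whole block positive, so after reflection the blocks
  stay strictly on their own side of \<open>c\<close> and the sign of d - c decides which copy is
  met.\<close>

lemma mem_Union_blocks_reflect: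
  assumes "\<And>z. z \<in> Z \<Longrightarrow> z \<ge> 6"
  shows "d \<in> (\<Union>z\<in>reflect c Z. block z) \<longleftrightarrow> \<bar>d - c\<bar> \<in> (\<Union>z\<in>Z. block z)"
proof -
  have "d \<in> block (c + z) \<or> d \<in> block (c - z) \<longleftrightarrow> \<bar>d - c\<bar> \<in> block z" if "z \<in> Z" for z
  proof -
    have plus: "c + t \<in> block (c + z) \<longleftrightarrow> t \<in> block z"
      and minus: "c - t \<in> block (c - z) \<longleftrightarrow> t \<in> block z" for t
      by (auto simp: block_def)
    have apart: "c + t \<notin> block (c - z)" "c - t \<notin> block (c + z)" if "t \<ge> 0" for t
      using assms[OF \<open>z \<in> Z\<close>] that by (auto simp: block_def)
    show ?thesis
    proof (cases "d \<ge> c")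
      case True
      then show ?thesis
        using plus[of "d - c"] apart[of "d - c"] by simp
    next
      case False
      then show ?thesis
        using minus[of "c - d"] apart[of "c - d"] by simp
    qed
  qed
  then show ?thesis
    unfolding reflect_def by blast
qed

section \<open>The valid extensions of \<open>V\<^sub>n\<close>\<close>

text \<open>The centres of the runs allowed for the new anti-diagonal in column \<open>m + 5\<close>.\<close>

primrec centres :: "nat \<Rightarrow> int set" where
  "centres 0 = {6}"
| "centres (Suc m) = reflect (2 ^ (m + 4) - 2) (centres m)"

text \<open>The two bounds sustain each other: subtracting the upper one from 2^(m+4) - 2 gives 6 +
  2(m+1), and adding it gives the next upper bound. The upper bound also places valid extensions
  among the candidates.\<close>

lemma centres_bounds:
  "z \<in> centres m \<Longrightarrow> 6 + 2 * int m \<le> z \<and> z \<le> 2 ^ (m + 4) - 2 * int m - 10 \<and> even z"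
proof (induction m arbitrary: z)
  case (Suc m)
  then obtain w where w: "w \<in> centres m" and "z = 2 ^ (m + 4) - 2 + w \<or> z = 2 ^ (m + 4) - 2 - w"
    by (auto simp: reflect_def)
  moreover have "(2::int) ^ (Suc m + 4) = 2 * 2 ^ (m + 4)" "even ((2::int) ^ (m + 4))"
    by (simp_all add: power_add)
  ultimately show ?case
    using Suc.IH[OF w] by (auto simp del: even_power)
qed simp

lemma centres_ge: "z \<in> centres m \<Longrightarrow> z \<ge> 6"
  using centres_bounds[of z m] by simp

lemma finite_centres: "finite (centres m)"
  by (induction m) (auto simp: reflect_def)

lemma separated_centres: "separated (centres m)"
  by (induction m) (auto simp: separated_def[of "{6}"] intro!: separated_reflect dest: centres_ge)

lemma card_centres: "card (centres m) = 2 ^ m"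
proof (induction m)
  case (Suc m)
  then show ?case
    using card_reflect[OF finite_centres, of m] centres_ge[of _ m] by fastforce
qed simp

lemma valid_extension_V_seq_iff:
  assumes "n \<ge> 5"
  shows "k \<in> valid_extensions (V_seq n)
    \<longleftrightarrow> \<bar>k - last (V_seq n)\<bar> \<in> (\<Union>z\<in>centres (n - 5). block z)"
proof -
  define E where "E a = entry (V_seq n @ [k]) (n + 1 - a) a" for a
  have E_step: "E a = \<bar>E (a + 1) - entry (V_seq n) (n - a) a\<bar>" if "1 \<le> a" "a \<le> n" for a
    using antidiagonal_append[of a "V_seq n" k] that unfolding E_def by simp
  have E_fold: "E a = \<bar>E (a + 1) - (2 ^ (a - 1) - 2)\<bar>" if "2 \<le> a" "a \<le> n - 1" for a
    using E_step[of a] entry_V_seq_antidiagonal[OF assms that] that by simp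
  have "E 2 = \<bar>E 3\<bar>" "E 3 = \<bar>E 4 - 2\<bar>" "E 4 = \<bar>E 5 - 6\<bar>"
    using E_fold[of 2] E_fold[of 3] E_fold[of 4] assms by auto
  moreover have "E 1 = \<bar>E 2 - 1\<bar>"
    using E_step[of 1] entry_V_seq_last[OF assms] assms by (simp add: numeral_2_eq_2)
  moreover have "E 5 \<ge> 0"
    using E_step[of 5] assms by simp
  \<comment> \<open>Backwards: \<open>E 2\<close> and \<open>E 3\<close> lie in {0, 2},
    \<open>E 4\<close> in {0, 2, 4}, hence \<open>E 5\<close> in {2, 4, 6, 8, 10}.\<close>
  ultimately have base: "E 1 = 1 \<longleftrightarrow> E 5 \<in> block 6"
    unfolding block_def by simp arith
  \<comment> \<open>The induction stops at column \<open>n\<close>: the remaining fold is at the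
    last term, which is not of the form 2^(a-1) - 2.\<close>
  have level: "E 1 = 1 \<longleftrightarrow> E (m + 5) \<in> (\<Union>z\<in>centres m. block z)" if "m + 5 \<le> n" for m
    using that
  proof (induction m)
    case 0
    then show ?case
      using base by simp
  next
    case (Suc m)
    have "m + 5 - 1 = m + 4"
      by simp
    then have "E (m + 5) = \<bar>E (Suc m + 5) - (2 ^ (m + 4) - 2)\<bar>"
      using E_fold[of "m + 5"] Suc.prems by (simp add: add.commute)
    then show ?case
      using Suc mem_Union_blocks_reflect[of "centres m" "E (Suc m + 5)" "2 ^ (m + 4) - 2", OF centres_ge]
      by simp
  qed
  have "V_seq n \<noteq> []"
    using assms length_V_seq[of n] by fastforce
  then have "k \<in> valid_extensions (V_seq n) \<longleftrightarrow> E 1 = 1"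
    using gilbreath_append_iff[OF gilbreath_V_seq[OF assms]]
    by (simp add: valid_extensions_def E_def)
  also have "\<dots> \<longleftrightarrow> E n \<in> (\<Union>z\<in>centres (n - 5). block z)"
    using level[of "n - 5"] assms by simp
  also have "E n = \<bar>k - last (V_seq n)\<bar>"
    using E_step[of n] assms \<open>V_seq n \<noteq> []\<close>
    by (simp add: E_def nth_append last_conv_nth)
  finally show ?thesis .
qed

lemma valid_extensions_V_seq:
  assumes "n \<ge> 5"
  shows "valid_extensions (V_seq n)
    = (\<Union>z\<in>reflect (last (V_seq n)) (centres (n - 5)). block z)"
  unfolding set_eq_iff
  using valid_extension_V_seq_iff[OF assms] mem_Union_blocks_reflect[OF centres_ge] by simp

lemma valid_extensions_V_seq_subset:
  assumes "n \<ge> 5"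
  shows "valid_extensions (V_seq n) \<subseteq> candidates (V_seq n)"
proof
  fix k assume "k \<in> valid_extensions (V_seq n)"
  then obtain z where z: "z \<in> centres (n - 5)" "\<bar>k - last (V_seq n)\<bar> \<in> block z"
    using valid_extension_V_seq_iff[OF assms] by blast
  obtain m where m: "n = m + 5"
    using assms by (metis add.commute le_Suc_ex)
  have "even z"
    using centres_bounds[OF z(1)] by simp
  then have "\<bar>k - last (V_seq n)\<bar> \<le> z + 4" "even \<bar>k - last (V_seq n)\<bar>"
    using z(2) by (auto simp only: block_def insert_iff empty_iff) simp_all
  \<comment> \<open>For n = m + 5 the right side is 2^(m+4) - 2m - 6, exactly 4 above the upper
    bound on centres in \<open>centres_bounds\<close>.\<close>
  moreover have "z + 4 \<le> antidiagonal_sum (V_seq n) + 1"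
    using centres_bounds[OF z(1)] m antidiagonal_sum_V_seq[OF assms] by (simp add: add.commute)
  ultimately show "k \<in> candidates (V_seq n)"
    unfolding candidates_def cong_iff_dvd_diff mem_Collect_eq dvd_abs_iff by linarith
qed

section \<open>Counting candidates and holes\<close>

lemma card_centred_even_interval:
  fixes s A :: int
  assumes "A \<ge> 0"
  shows "card {k. \<bar>k - s\<bar> \<le> 2 * A \<and> [k = s] (mod 2)} = nat (2 * A + 1)"
proof -
  have "{k. \<bar>k - s\<bar> \<le> 2 * A \<and> [k = s] (mod 2)} = (\<lambda>i. s + 2 * i) ` {-A..A}"
  proof (intro equalityI subsetI)
    fix k assume k: "k \<in> {k. \<bar>k - s\<bar> \<le> 2 * A \<and> [k = s] (mod 2)}"
    then obtain i where "k - s = 2 * i"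
      unfolding cong_iff_dvd_diff dvd_def by blast
    then show "k \<in> (\<lambda>i. s + 2 * i) ` {-A..A}"
      using k by (intro image_eqI[of _ _ i]) auto
  qed (auto simp: cong_iff_dvd_diff)
  moreover have "inj_on (\<lambda>i. s + 2 * i) {-A..A}"
    by (simp add: inj_on_def)
  ultimately show ?thesis
    using assms by (simp add: card_image)
qed

theorem theorem35:
  fixes n :: nat
  assumes "n \<ge> 5"
  shows "card (valid_extensions (V_seq n)) = 5 * 2 ^ (n - 4)
    \<and> num_comp (valid_extensions (V_seq n)) = 2 ^ (n - 4)
    \<and> int (defect (V_seq n)) = 3 * 2 ^ (n - 4) - 2 * int n + 5"
proof (intro conjI)
  let ?K = "valid_extensions (V_seq n)" and ?C = "candidates (V_seq n)"
  define Z where "Z = reflect (last (V_seq n)) (centres (n - 5))"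
  obtain m where m: "n = m + 5"
    using assms by (metis add.commute le_Suc_ex)
  have K: "?K = (\<Union>z\<in>Z. block z)"
    using valid_extensions_V_seq[OF assms] by (simp add: Z_def)
  have Z: "finite Z" "separated Z"
    unfolding Z_def using separated_reflect[OF separated_centres centres_ge] finite_centres
    by (auto simp: reflect_def)
  have card_Z: "card Z = 2 ^ (n - 4)"
    unfolding Z_def using card_reflect[OF finite_centres, of "n - 5"] centres_ge[of _ "n - 5"]
    by (fastforce simp: card_centres m)
  show card_K: "card ?K = 5 * 2 ^ (n - 4)"
    unfolding K using card_Union_blocks[OF Z] card_Z by simp
  show "num_comp ?K = 2 ^ (n - 4)"
    unfolding K using num_comp_Union_blocks[OF Z(2)] card_Z by simp
  \<comment> \<open>Half of \<open>antidiagonal_sum (V_seq n) + 1\<close>, written with n = m +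
    5.\<close>
  define A where "A = 2 ^ (m + 3) - int m - 3"
  have "int m + 1 \<le> 2 ^ m"
    by (induction m) auto
  moreover have "(1::int) \<le> 2 ^ m"
    by simp
  ultimately have "A \<ge> 0"
    by (simp add: A_def power_add)
  moreover have "antidiagonal_sum (V_seq n) + 1 = 2 * A"
    using antidiagonal_sum_V_seq[OF assms] by (simp add: A_def m power_add)
  ultimately have card_C: "int (card ?C) = 2 * A + 1"
    using card_centred_even_interval[of A "last (V_seq n)"] by (simp add: candidates_def)
  \<comment> \<open>Infinite sets have \<open>card\<close> 0, so positivity yields
    finiteness.\<close>
  have "card ?C > 0"
    using card_C \<open>A \<ge> 0\<close> by linarith
  then have "finite ?C"
    by (rule card_ge_0_finite)
  moreover from this have "finite ?K" "card ?K \<le> card ?C"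
    using valid_extensions_V_seq_subset[OF assms] by (auto intro: card_mono finite_subset)
  ultimately have "int (defect (V_seq n)) = int (card ?C) - int (card ?K)"
    using valid_extensions_V_seq_subset[OF assms]
    by (simp add: defect_def holes_def card_Diff_subset of_nat_diff)
  \<comment> \<open>The leading terms are 8 * 2^(n-4) candidates minus 5 * 2^(n-4) valid
    extensions.\<close>
  then show "int (defect (V_seq n)) = 3 * 2 ^ (n - 4) - 2 * int n + 5"
    using card_C card_K by (simp add: A_def m power_add)
qed

end
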